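(* Let $m\in\mathbb{N}$ and let $k\in\mathbb{Z}$ with $k<0$, $m>|k|$ and $\gcd(m,k)=1$. For each real $c>0$ let $p_c(z) = z^m + c\,(z^{k} + \overline{z}^{k}) - 1$ for $z\in\mathbb{C}\setminus\{0\}$, and let $Z(c)$ be the number of zeros of $p_c$ in $\mathbb{C}\setminus\{0\}$. Then, as $c$ increases over $(0,\infty)$, $Z(c)$ decreases monotonically (i.e. is non-increasing) from a maximum of $M+N$ to a minimum of $M$ (both values being attained), where $M$ and $N$ are determined as follows: \begin{itemize} \item if $m\equiv 0 \pmod 4$, then $M=m+1$ and $N=m-2$; \item if $m\equiv 1 \pmod 4$ and $k$ is odd, then $M=m-1$ and $N=m+1$; \item if $m\equiv 1 \pmod 4$ and $k$ is even, then $M=m$ and $N=m+1$; \item if $m\equiv 2 \pmod 4$, then $M=m-1$ and $N=m$; \item if $m\equiv 3 \pmod 4$ and $k$ is odd, then $M=m+1$ and $N=m-1$; \item if $m\equiv 3 \pmod 4$ and $k$ is even, then $M=m$ and $N=m-1$. \end{itemize}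
   Context: Zeros are counted as distinct points of $\mathbb{C}\setminus\{0\}$ (without multiplicity). $\overline{z}$ denotes the complex conjugate of $z$, and $\mathbb{N}$ the positive integers. *)

theory Defs
  imports Complex_Main
begin

definition p :: "nat \<Rightarrow> int \<Rightarrow> real \<Rightarrow> complex \<Rightarrow> complex" where
  "p m k c z = z ^ m + of_real c * (z powi k + cnj z powi k) - 1"

text \<open>The condition \<open>z \<noteq> 0\<close> is essential: for \<open>k < 0\<close> the term \<open>0 powi k\<close> is \<open>0\<close>.\<close>

definition zeros :: "nat \<Rightarrow> int \<Rightarrow> real \<Rightarrow> complex set" where
  "zeros m k c = {z. z \<noteq> 0 \<and> p m k c z = 0}"

definition Z :: "nat \<Rightarrow> int \<Rightarrow> real \<Rightarrow> nat" where
  "Z m k c = card (zeros m k c)"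

end

theory Submission
  imports Defs
begin

text \<open>
  Write \<open>k = - n\<close> with \<open>n > 0\<close>. Since \<open>z powi k + cnj z powi k\<close> is real, the imaginary part of \<open>p\<close>
  vanishes at \<open>z = r e\<^sup>i\<^sup>t\<close> exactly when \<open>sin (m t) = 0\<close>. So every zero lies on one of the \<open>2 m\<close> rays
  \<open>t = \<pi> j / m\<close>, and there the real part gives the equation
  \<open>(- 1)\<^sup>j r\<^sup>m + 2 c C\<^sub>j / r\<^sup>n = 1\<close> with \<open>C\<^sub>j = cos (n \<pi> j / m)\<close>
  (lemma \<open>zeros_bij_betw_ray_radii\<close>).

  On an odd ray the equation reads \<open>r\<^sup>n (1 + r\<^sup>m) = 2 c C\<^sub>j\<close> with an increasing left side, so there is
  one solution if \<open>C\<^sub>j > 0\<close> and none otherwise, whatever \<open>c\<close> is. On an even ray it reads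
  \<open>r\<^sup>n (1 - r\<^sup>m) = 2 c C\<^sub>j\<close>, where the left side climbs from \<open>0\<close> to a maximum \<open>\<mu>\<close> and then falls to
  \<open>- \<infinity>\<close>. This gives one solution if \<open>C\<^sub>j \<le> 0\<close>, and if \<open>C\<^sub>j > 0\<close> the number drops from \<open>2\<close> over
  \<open>1\<close> to \<open>0\<close> as \<open>2 c C\<^sub>j\<close> passes \<open>\<mu>\<close> (lemma \<open>even_ray_card\<close>). The number \<open>\<mu>\<close> is the same for all
  rays. Hence the zero count is non-increasing in \<open>c\<close>. Its minimum \<open>M\<close> is the number of odd rays with
  \<open>C\<^sub>j > 0\<close> plus the number of even rays with \<open>C\<^sub>j \<le> 0\<close>, attained for large \<open>c\<close>; the excess \<open>N\<close> of
  the maximum, attained for small \<open>c\<close>, is twice the number of even rays with \<open>C\<^sub>j > 0\<close>.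

  It remains to count signs. The cosine \<open>C\<^sub>j\<close> depends on \<open>n j\<close> modulo \<open>2 m\<close>. Because \<open>n\<close> and \<open>m\<close> are
  coprime, multiplication by \<open>n\<close> carries the even \<open>j\<close> bijectively onto the even residues, and the odd
  \<open>j\<close> onto the residues that have the parity of \<open>n\<close> (lemma \<open>progression_residues\<close>). So the counts are
  numbers of even or odd residues in the open right half circle, which depend on \<open>m\<close> modulo \<open>4\<close>;
  this is where the cases of the theorem come from.
\<close>

section \<open>Reduction to rays\<close>

lemma p_polar:
  fixes r t c :: real
  shows "Re (p m (- int n) c (rcis r t)) = r ^ m * cos (m * t) + 2 * c * cos (n * t) / r ^ n - 1"
    and "Im (p m (- int n) c (rcis r t)) = r ^ m * sin (m * t)"
proof -
  have conj: "cnj (rcis r t) = rcis r (- t)"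
    by (simp add: rcis_def cis_cnj)
  have powi: "rcis r s powi (- int n) = rcis (1 / r ^ n) (- (n * s))" for s :: real
    by (simp add: power_int_minus DeMoivre2 rcis_inverse)
  have pw: "rcis r t ^ m = rcis (r ^ m) (m * t)"
    by (simp add: DeMoivre2)
  show "Re (p m (- int n) c (rcis r t)) = r ^ m * cos (m * t) + 2 * c * cos (n * t) / r ^ n - 1"
    and "Im (p m (- int n) c (rcis r t)) = r ^ m * sin (m * t)"
    unfolding p_def conj powi pw by simp_all
qed

text \<open>
  The moduli of the zeros on the ray of angle \<open>\<pi> j / m\<close>: on this ray \<open>z\<^sup>m = (- 1)\<^sup>j \<bar>z\<bar>\<^sup>m\<close>.
\<close>

definition ray_radii :: "nat \<Rightarrow> nat \<Rightarrow> real \<Rightarrow> nat \<Rightarrow> real set" where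
  "ray_radii m n c j =
     {r. 0 < r \<and> (- 1) ^ j * r ^ m + 2 * c * cos (n * (pi * j / m)) / r ^ n = 1}"

lemma rcis_zero_iff_ray_radius:
  assumes "m > 0" "r > 0"
  shows "rcis r (pi * j / m) \<in> zeros m (- int n) c \<longleftrightarrow> r \<in> ray_radii m n c j"
proof -
  have "real m * (pi * j / m) = pi * j"
    using assms by simp
  then have "cos (m * (pi * j / m)) = (- 1) ^ j" "sin (m * (pi * j / m)) = 0"
    by (simp_all only: mult.commute[of pi] cos_npi sin_npi)
  moreover have "rcis r (pi * j / m) \<noteq> 0"
    using assms(2) complex_mod_rcis[of r "pi * j / m"] by force
  ultimately show ?thesis
    using assms(2) p_polar[where m = m and n = n and c = c and r = r and t = "pi * j / m"]
      complex_eq_iff[of "p m (- int n) c (rcis r (pi * j / m))" 0]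
    by (simp add: zeros_def ray_radii_def mult.commute del: times_divide_eq_right)
qed

lemma polar_angle_exists:
  assumes "z \<noteq> 0"
  obtains r t where "r > 0" "0 \<le> t" "t < 2 * pi" "z = rcis r t"
proof (cases "Arg z \<ge> 0")
  case True
  then show ?thesis
    using that[of "cmod z" "Arg z"] assms Arg_bounded[of z]
    by (simp add: rcis_cmod_Arg)
next
  case False
  have "cis (Arg z + 2 * pi) = cis (Arg z)"
    by (simp add: complex_eq_iff)
  then have "z = rcis (cmod z) (Arg z + 2 * pi)"
    using rcis_cmod_Arg[of z] by (simp add: rcis_def)
  with False show ?thesis
    using that[of "cmod z" "Arg z + 2 * pi"] assms Arg_bounded[of z] by simp
qed

lemma rcis_inj_on:
  assumes "r > 0" "0 \<le> t" "t < 2 * pi" "r' > 0" "0 \<le> t'" "t' < 2 * pi"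
    and eq: "rcis r t = rcis r' t'"
  shows "r = r' \<and> t = t'"
proof
  show r: "r = r'"
    using arg_cong[OF eq, of cmod] assms(1,4) by simp
  then have "cis t = cis t'"
    using eq assms by (simp add: rcis_def)
  then obtain n :: int where n: "t = t' + 2 * pi * n"
    using sin_cos_eq_iff[of t t'] by (auto simp: complex_eq_iff)
  have "\<bar>2 * pi * n\<bar> < 2 * pi"
    using n assms by linarith
  then have "\<bar>real_of_int n\<bar> < 1"
    by (simp add: abs_mult)
  then have "n = 0"
    by linarith
  then show "t = t'"
    using n by simp
qed

text \<open>
  A vanishing imaginary part forces \<open>m t\<close> to be a multiple of \<open>\<pi>\<close>, and \<open>2 m\<close> consecutive multiples
  cover one full turn, so each zero is hit once.
\<close>

lemma zeros_bij_betw_ray_radii: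
  assumes m: "m > 0"
  shows "bij_betw (\<lambda>(j, r). rcis r (pi * real j / real m))
           (SIGMA j:{..<2 * m}. ray_radii m n c j) (zeros m (- int n) c)"
proof -
  let ?t = "\<lambda>j::nat. pi * real j / real m"
  have angle: "0 \<le> ?t j \<and> ?t j < 2 * pi" if "j < 2 * m" for j
  proof -
    have "pi * real j < pi * (2 * real m)"
      using that by simp
    then show ?thesis
      using m by (simp add: divide_simps mult_ac)
  qed
  have inj: "inj_on (\<lambda>(j, r). rcis r (?t j)) (SIGMA j:{..<2 * m}. ray_radii m n c j)"
  proof (rule inj_onI, clarsimp)
    fix i j :: nat and r s
    assume *: "i < 2 * m" "j < 2 * m" "r \<in> ray_radii m n c i" "s \<in> ray_radii m n c j"
      "rcis r (?t i) = rcis s (?t j)"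
    then have "r = s \<and> ?t i = ?t j"
      by (intro rcis_inj_on) (auto simp: ray_radii_def angle)
    then show "i = j \<and> r = s"
      using m by simp
  qed
  have "z \<in> (\<lambda>(j, r). rcis r (?t j)) ` (SIGMA j:{..<2 * m}. ray_radii m n c j)"
    if z: "z \<in> zeros m (- int n) c" for z
  proof -
    obtain r t where rt: "r > 0" "0 \<le> t" "t < 2 * pi" "z = rcis r t"
      using polar_angle_exists[of z] z by (auto simp: zeros_def)
    have "sin (m * t) = 0"
      using p_polar(2)[where m = m and n = n and c = c and r = r and t = t] z rt by (simp add: zeros_def)
    then obtain i :: int where i: "m * t = i * pi"
      using sin_zero_iff_int2 by blast
    have "0 \<le> i * pi" "i * pi < (2 * m) * pi"
      using rt m by (simp_all flip: i)
    then have "0 \<le> i" "real_of_int i < real_of_int (2 * int m)"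
      using pi_gt_zero by (simp_all add: zero_le_mult_iff)
    then obtain j :: nat where j: "i = int j" "j < 2 * m"
      by (metis of_int_less_iff of_nat_less_iff of_nat_mult of_nat_numeral zero_le_imp_eq_int)
    have "t = ?t j"
      using i j m by (simp add: field_simps)
    moreover from this have "r \<in> ray_radii m n c j"
      using rcis_zero_iff_ray_radius[OF m rt(1), of j n c] rt z by simp
    ultimately show ?thesis
      using j rt by force
  qed
  moreover have "rcis r (?t j) \<in> zeros m (- int n) c" if "r \<in> ray_radii m n c j" for j r
    using rcis_zero_iff_ray_radius[OF m, of r j n c] that by (auto simp: ray_radii_def)
  ultimately have "(\<lambda>(j, r). rcis r (?t j)) ` (SIGMA j:{..<2 * m}. ray_radii m n c j)
      = zeros m (- int n) c"
    by auto
  with inj show ?thesis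
    by (simp add: bij_betw_def)
qed

section \<open>Counting radii on a ray\<close>

text \<open>
  On an odd ray the equation, multiplied by \<open>r\<^sup>n\<close>, asks where a strictly increasing function with
  value \<open>0\<close> at \<open>0\<close> takes the value \<open>A\<close>.
\<close>

lemma odd_ray_card:
  fixes A :: real
  assumes m: "m > 0" and n: "n > 0"
  defines "S \<equiv> {r. 0 < r \<and> - (r ^ m) + A / r ^ n = 1}"
  shows "finite S \<and> card S = (if A > 0 then 1 else 0)"
proof -
  define g :: "real \<Rightarrow> real" where "g = (\<lambda>r. r ^ n * (1 + r ^ m))"
  have S: "S = {r. 0 < r \<and> g r = A}"
    by (auto simp: S_def g_def field_simps)
  have incr: "g r < g s" if "0 < r" "r < s" for r s
    unfolding g_def using that m n
    by (intro mult_strict_mono add_strict_left_mono power_strict_mono) (auto intro: add_pos_pos)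
  show ?thesis
  proof (cases "A > 0")
    case True
    (* The function has reached A at 1 + A, because both of its factors are bounded below there: by 1 and by A. *)
    have "\<exists>r\<ge>0. r \<le> 1 + A \<and> g r = A"
    proof (rule IVT')
      have "1 * A \<le> (1 + A) ^ n * (1 + (1 + A) ^ m)"
        using True m self_le_power[of "1 + A" m]
        by (intro mult_mono) (auto intro: one_le_power)
      then show "A \<le> g (1 + A)"
        by (simp add: g_def)
    qed (use True n in \<open>auto simp: g_def zero_power intro!: continuous_intros\<close>)
    then obtain r where r: "r \<ge> 0" "g r = A"
      by blast
    moreover have "r \<noteq> 0"
      using r True n by (auto simp: g_def zero_power)
    moreover have "s = r" if "0 < s" "g s = g r" for s
      using incr[of s r] incr[of r s] that r(1) \<open>r \<noteq> 0\<close> by linarith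
    ultimately have "S = {r}"
      unfolding S by auto
    then show ?thesis
      using True by simp
  next
    case False
    have "g r > 0" if "r > 0" for r
      using that by (simp add: g_def add_pos_pos)
    with False have "S = {}"
      unfolding S by fastforce
    then show ?thesis
      using False by simp
  qed
qed

text \<open>
  The number of positive solutions of \<open>g r = A\<close> for a function \<open>g\<close> that starts at \<open>0\<close>, rises strictly
  to its maximum \<open>\<mu>\<close> and then falls strictly without bound.
\<close>

definition even_ray_count :: "real \<Rightarrow> real \<Rightarrow> nat" where
  "even_ray_count \<mu> A = (if A \<le> 0 then 1 else if A < \<mu> then 2 else if A = \<mu> then 1 else 0)"

text \<open>
  The function \<open>r\<^sup>n (1 - r\<^sup>m)\<close> has a single positive critical point \<open>r\<^sub>0\<close>, where
  \<open>r\<^sub>0\<^sup>m = n / (m + n)\<close>. A level \<open>A\<close> is met at most once before \<open>r\<^sub>0\<close> and at most once after it. The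
  threshold \<open>\<mu>\<close>, the value at \<open>r\<^sub>0\<close>, does not depend on \<open>A\<close>; one \<open>\<mu>\<close> therefore serves all rays
  and all parameters.
\<close>

lemma even_ray_card:
  assumes m: "m > 0" and n: "n > 0"
  obtains \<mu> :: real where "\<mu> > 0"
    and "\<And>A :: real. finite {r. 0 < r \<and> r ^ m + A / r ^ n = 1}"
    and "\<And>A. card {r. 0 < r \<and> r ^ m + A / r ^ n = 1} = even_ray_count \<mu> A"
proof -
  define g :: "real \<Rightarrow> real" where "g = (\<lambda>r. r ^ n * (1 - r ^ m))"
  define r0 where "r0 = root m (n / (m + n))"
  have r0: "r0 > 0" "r0 ^ m = n / (m + n)"
    using m n by (auto simp: r0_def)
  have g0: "g 0 = 0"
    using n by (simp add: g_def)
  have cont: "continuous_on X g" for X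
    unfolding g_def by (intro continuous_intros)
  have deriv: "(g has_real_derivative r ^ (n - 1) * (m + n) * (r0 ^ m - r ^ m)) (at r)" for r :: real
  proof -
    have "m * r ^ (m - 1) * r ^ n = m * r ^ (n - 1) * r ^ m"
      using m n by (simp add: add.commute flip: power_add)
    then have "n * r ^ (n - 1) * (1 - r ^ m) - m * r ^ (m - 1) * r ^ n
        = n * r ^ (n - 1) * (1 - r ^ m) - m * r ^ (n - 1) * r ^ m"
      by (rule arg_cong)
    also have "\<dots> = r ^ (n - 1) * (n - (m + n) * r ^ m)"
      by (simp add: algebra_simps)
    also have "\<dots> = r ^ (n - 1) * (m + n) * (r0 ^ m - r ^ m)"
      using n by (simp add: r0 field_simps)
    finally show ?thesis
      unfolding g_def by (auto intro!: derivative_eq_intros simp: algebra_simps)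
  qed
  have incr: "g r < g s" if "0 \<le> r" "r < s" "s \<le> r0" for r s
  proof (rule DERIV_pos_imp_increasing_open[OF that(2) _ cont])
    fix x assume "r < x" "x < s"
    then have "0 < x ^ (n - 1) * (m + n) * (r0 ^ m - x ^ m)"
      using that m by (auto intro!: mult_pos_pos power_strict_mono)
    then show "\<exists>y. (g has_real_derivative y) (at x) \<and> 0 < y"
      using deriv by blast
  qed
  have decr: "g s < g r" if "r0 \<le> r" "r < s" for r s
  proof (rule DERIV_neg_imp_decreasing_open[OF that(2) _ cont])
    fix x assume "r < x" "x < s"
    then have "x ^ (n - 1) * (m + n) * (r0 ^ m - x ^ m) < 0"
      using that m r0(1) by (intro mult_pos_neg mult_pos_pos) (auto intro!: power_strict_mono)
    then show "\<exists>y. (g has_real_derivative y) (at x) \<and> y < 0"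
      using deriv by blast
  qed
  define \<mu> where "\<mu> = g r0"
  have \<mu>: "\<mu> > 0"
    using incr[of 0 r0] r0 g0 by (simp add: \<mu>_def)
  have rising: "\<exists>r. 0 < r \<and> r \<le> r0 \<and> g r = A" if "0 < A" "A \<le> \<mu>" for A
  proof -
    have "\<exists>r\<ge>0. r \<le> r0 \<and> g r = A"
      using that r0 g0 cont by (intro IVT') (auto simp: \<mu>_def)
    then show ?thesis
      using that g0 by (metis less_irrefl order_le_less)
  qed
  have falling: "\<exists>r\<ge>r0. g r = A" if "A \<le> \<mu>" for A
  proof -
    (* Past 1 the function is at most 1 - r, so this point is far enough out for a value below A. *)
    let ?R = "1 + \<bar>A\<bar> + r0"
    have R: "1 \<le> ?R ^ n" "?R \<le> ?R ^ m"
      using r0 m by (auto intro!: one_le_power self_le_power)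
    then have "?R ^ n * (1 - ?R ^ m) \<le> 1 * (1 - ?R ^ m)"
      using r0 by (intro mult_right_mono_neg) auto
    then have "g ?R \<le> A"
      using R r0 by (simp add: g_def)
    then have "\<exists>r\<ge>r0. r \<le> ?R \<and> g r = A"
      using that cont by (intro IVT2') (auto simp: \<mu>_def)
    then show ?thesis
      by blast
  qed
  have le_\<mu>: "g r \<le> \<mu>" if "r > 0" for r
    using incr[of r r0] decr[of r0 r] that by (cases r r0 rule: linorder_cases) (auto simp: \<mu>_def)
  have inj_l: "r = s" if "0 \<le> r" "r \<le> r0" "0 \<le> s" "s \<le> r0" "g r = g s" for r s
    using incr that by (metis linorder_neqE order_less_irrefl)
  have inj_r: "r = s" if "r0 \<le> r" "r0 \<le> s" "g r = g s" for r s
    using decr that by (metis linorder_neqE order_less_irrefl)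
  have "finite {r. 0 < r \<and> g r = A} \<and> card {r. 0 < r \<and> g r = A} = even_ray_count \<mu> A" for A
  proof -
    consider "A \<le> 0" | "0 < A" "A < \<mu>" | "A = \<mu>" | "\<mu> < A"
      by linarith
    then show ?thesis
    proof cases
      case 1
      then obtain b where b: "b \<ge> r0" "g b = A"
        using falling[of A] \<mu> by auto
      have "r \<ge> r0" if "0 < r" "g r = A" for r
        using incr[of 0 r] that g0 1 by linarith
      then have "{r. 0 < r \<and> g r = A} = {b}"
        using b r0 inj_r by force
      then show ?thesis
        using 1 by (simp add: even_ray_count_def)
    next
      case 2
      then obtain a b where ab: "0 < a" "a \<le> r0" "g a = A" "b \<ge> r0" "g b = A"
        using rising[of A] falling[of A] by auto
      then have "a \<noteq> b"
        using 2 by (auto simp: \<mu>_def)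
      moreover have "r = a \<or> r = b" if "0 < r" "g r = A" for r
        using inj_l[of r a] inj_r[of r b] that ab by linarith
      then have "{r. 0 < r \<and> g r = A} = {a, b}"
        using ab r0 by auto
      ultimately show ?thesis
        using 2 by (simp add: even_ray_count_def)
    next
      case 3
      have "r = r0" if "0 < r" "g r = g r0" for r
        using inj_l[of r r0] inj_r[of r r0] that r0(1) by linarith
      then have "{r. 0 < r \<and> g r = A} = {r0}"
        using 3 r0(1) by (auto simp: \<mu>_def)
      then show ?thesis
        using 3 \<mu> by (simp add: even_ray_count_def)
    next
      case 4
      then have empty: "{r. 0 < r \<and> g r = A} = {}"
        using le_\<mu> by fastforce
      show ?thesis
        unfolding empty using 4 \<mu> by (simp add: even_ray_count_def)
    qed
  qed
  moreover have "{r. 0 < r \<and> r ^ m + A / r ^ n = 1} = {r. 0 < r \<and> g r = A}" for A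
    by (auto simp: g_def field_simps)
  ultimately show thesis
    using that[OF \<mu>] by simp
qed

section \<open>Counting rays by the sign of the cosine\<close>

lemma cos_pos_iff_residue:
  fixes x m :: nat
  assumes m: "m > 0"
  defines "a \<equiv> x mod (2 * m)"
  shows "cos (pi * x / m) > 0 \<longleftrightarrow> 2 * a < m \<or> 3 * m < 2 * a"
proof -
  define y where "y = pi * a / m"
  have "real x = real (2 * m * (x div (2 * m)) + a)"
    unfolding a_def by (metis mult_div_mod_eq)
  then have "pi * x / m = y + 2 * pi * of_int (int (x div (2 * m)))"
    using m by (simp add: y_def field_simps)
  then have per: "cos (pi * x / m) = cos y"
    using sin_cos_eq_iff by blast
  have scale: "y < q * pi \<longleftrightarrow> a < q * m" "y \<le> q * pi \<longleftrightarrow> a \<le> q * m"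
      "q * pi < y \<longleftrightarrow> q * m < a" "q * pi \<le> y \<longleftrightarrow> q * m \<le> a" for q :: real
    using m mult_less_cancel_left_pos[OF pi_gt_zero, of a "q * m"]
      mult_less_cancel_left_pos[OF pi_gt_zero, of "q * m" a]
      mult_le_cancel_left_pos[OF pi_gt_zero, of a "q * m"]
      mult_le_cancel_left_pos[OF pi_gt_zero, of "q * m" a]
    by (simp_all add: y_def field_simps)
  have a: "a < 2 * m"
    using m by (simp add: a_def)
  then have y: "0 \<le> y" "y < 2 * pi"
    using scale(1)[of 2] by (simp_all add: y_def)
  consider "2 * a < m" | "m \<le> 2 * a" "2 * a \<le> 3 * m" | "3 * m < 2 * a"
    by linarith
  then show ?thesis
  proof cases
    case 1
    then have "y < pi / 2"
      using scale(1)[of "1/2"] by simp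
    then have "cos y > 0"
      using y by (intro cos_gt_zero_pi) auto
    then show ?thesis
      using 1 per by simp
  next
    case 2
    then have "pi / 2 \<le> y" "y \<le> 3 / 2 * pi"
      using scale(4)[of "1/2"] scale(2)[of "3/2"] by simp_all
    then have "cos (y - pi) \<ge> 0"
      by (intro cos_ge_zero) auto
    then show ?thesis
      using 2 per by simp
  next
    case 3
    then have "3 / 2 * pi < y"
      using scale(3)[of "3/2"] by simp
    then have "cos (y - 2 * pi) > 0"
      using y by (intro cos_gt_zero_pi) auto
    then show ?thesis
      using 3 per by (simp add: cos_diff)
  qed
qed

text \<open>
  If two indices give the same residue, then \<open>2 m\<close> divides \<open>2 n (j - i)\<close>, hence \<open>m\<close> divides \<open>j - i\<close> by
  coprimality. So the map is injective, and its target has exactly \<open>m\<close> elements. With \<open>s = 0\<close> the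
  index \<open>2 i + s\<close> runs through the even rays, with \<open>s = 1\<close> through the odd ones.
\<close>

lemma progression_residues:
  fixes m n s :: nat
  assumes m: "m > 0" and cop: "coprime m n"
  shows "bij_betw (\<lambda>i. n * (2 * i + s) mod (2 * m)) {..<m}
           {a. a < 2 * m \<and> (even a \<longleftrightarrow> even (n * s))}"
proof -
  let ?f = "\<lambda>i. n * (2 * i + s) mod (2 * m)"
  let ?T = "{a. a < 2 * m \<and> (even a \<longleftrightarrow> even (n * s))}"
  have "inj_on ?f {..<m}"
  proof (rule linorder_inj_onI')
    fix i j assume ij: "i \<in> {..<m}" "j \<in> {..<m}" "i < j"
    show "?f i \<noteq> ?f j"
    proof
      assume "?f i = ?f j"
      then have "2 * m dvd n * (2 * j + s) - n * (2 * i + s)"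
        using ij by (intro mod_eq_dvd_iff_nat[THEN iffD1]) auto
      also have "\<dots> = 2 * (n * (j - i))"
        by (simp add: algebra_simps)
      finally have "m dvd j - i"
        using cop by (simp add: coprime_dvd_mult_right_iff)
      then show False
        using ij by (auto dest: dvd_imp_le)
    qed
  qed
  moreover have "?f ` {..<m} \<subseteq> ?T"
    using m by (auto simp: dvd_mod_iff)
  moreover have "card ?T = m"
  proof -
    have "?T = (\<lambda>i. 2 * i + (if even (n * s) then 0 else 1)) ` {..<m}" (is "_ = ?g ` _")
    proof
      show "?T \<subseteq> ?g ` {..<m}"
      proof
        fix a assume "a \<in> ?T"
        then show "a \<in> ?g ` {..<m}"
          by (intro image_eqI[of _ _ "a div 2"]; cases "even (n * s)") auto
      qed
    qed auto
    then show ?thesis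
      by (simp add: card_image inj_on_def)
  qed
  moreover have "finite ?T"
    by (rule finite_subset[of _ "{..<2 * m}"]) auto
  ultimately show ?thesis
    by (simp add: bij_betw_def card_image card_subset_eq)
qed

text \<open>
  The number of residues modulo \<open>2 m\<close> of one parity (even if \<open>e\<close> holds, odd otherwise) whose angle
  \<open>\<pi> a / m\<close> lies in the open right half plane. There are \<open>(m + 3) div 4\<close> even and \<open>(m + 1) div 4\<close> odd
  numbers \<open>a \<ge> 0\<close> with \<open>2 a < m\<close>; the reflection \<open>a \<mapsto> 2 m - a\<close> doubles them, but \<open>0\<close> is its own mirror
  image.
\<close>

definition right_half_count :: "nat \<Rightarrow> bool \<Rightarrow> nat" where
  "right_half_count m e = (if e then 2 * ((m + 3) div 4) - 1 else 2 * ((m + 1) div 4))"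

lemma right_half_count_by_residue:
  assumes "m > 0"
  shows "m mod 4 = 0 \<Longrightarrow> 2 * right_half_count m True + 2 = m \<and> 2 * right_half_count m False = m"
    and "m mod 4 = 1 \<Longrightarrow> 2 * right_half_count m True = m + 1 \<and> 2 * right_half_count m False + 1 = m"
    and "m mod 4 = 2 \<Longrightarrow> 2 * right_half_count m True = m \<and> 2 * right_half_count m False + 2 = m"
    and "m mod 4 = 3 \<Longrightarrow> 2 * right_half_count m True + 1 = m \<and> 2 * right_half_count m False = m + 1"
proof -
  define q where "q = m div 4"
  have m: "m = 4 * q + m mod 4"
    by (simp add: q_def)
  show "2 * right_half_count m True + 2 = m \<and> 2 * right_half_count m False = m" if "m mod 4 = 0"
  proof -
    have "m = 4 * q" "q > 0"
      using m that assms by auto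
    then have "(m + 3) div 4 = q" "(m + 1) div 4 = q"
      by simp_all
    then show ?thesis
      using \<open>m = 4 * q\<close> \<open>q > 0\<close> by (simp add: right_half_count_def)
  qed
  show "2 * right_half_count m True = m + 1 \<and> 2 * right_half_count m False + 1 = m" if "m mod 4 = 1"
  proof -
    have "m = 4 * q + 1"
      using m that by simp
    then have "(m + 3) div 4 = q + 1" "(m + 1) div 4 = q"
      by simp_all
    then show ?thesis
      using \<open>m = 4 * q + 1\<close> by (simp add: right_half_count_def)
  qed
  show "2 * right_half_count m True = m \<and> 2 * right_half_count m False + 2 = m" if "m mod 4 = 2"
  proof -
    have "m = 4 * q + 2"
      using m that by simp
    then have "(m + 3) div 4 = q + 1" "(m + 1) div 4 = q"
      by simp_all
    then show ?thesis
      using \<open>m = 4 * q + 2\<close> by (simp add: right_half_count_def)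
  qed
  show "2 * right_half_count m True + 1 = m \<and> 2 * right_half_count m False = m + 1" if "m mod 4 = 3"
  proof -
    have "m = 4 * q + 3"
      using m that by simp
    then have "(m + 3) div 4 = q + 1" "(m + 1) div 4 = q + 1"
      by simp_all
    then show ?thesis
      using \<open>m = 4 * q + 3\<close> by (simp add: right_half_count_def)
  qed
qed

lemma card_residues_right_half:
  assumes m: "m > 0"
  shows "card {a. a < 2 * m \<and> (even a \<longleftrightarrow> e) \<and> (2 * a < m \<or> 3 * m < 2 * a)} = right_half_count m e"
proof -
  let ?S = "{a. a < 2 * m \<and> (even a \<longleftrightarrow> e) \<and> (2 * a < m \<or> 3 * m < 2 * a)}"
  show ?thesis
  proof (cases e)
    case True
    let ?q = "(m + 3) div 4"
    have "?S = (\<lambda>i. 2 * i) ` {..<?q} \<union> (\<lambda>i. 2 * m - 2 * i) ` {0<..<?q}" (is "_ = ?A \<union> ?B")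
    proof (intro equalityI subsetI)
      fix a assume a: "a \<in> ?S"
      show "a \<in> ?A \<union> ?B"
      proof (cases "2 * a < m")
        case l: True
        have "a = 2 * (a div 2)" "a div 2 < ?q"
          using a l True by auto
        then show ?thesis
          by blast
      next
        case False
        have "a = 2 * m - 2 * (m - a div 2)" "0 < m - a div 2" "m - a div 2 < ?q"
          using a False True by auto
        then show ?thesis
          by (metis UnI2 greaterThanLessThan_iff image_eqI)
      qed
    next
      fix a assume "a \<in> ?A \<union> ?B"
      then show "a \<in> ?S"
        using m True by auto
    qed
    moreover have "card ?A = ?q"
      by (simp add: card_image inj_on_def)
    moreover have "card ?B = ?q - 1"
    proof -
      have "inj_on (\<lambda>i. 2 * m - 2 * i) {0<..<?q}"
        by (rule inj_onI) auto
      then show ?thesis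
        by (simp add: card_image)
    qed
    moreover have "?A \<inter> ?B = {}"
      by auto
    moreover have "0 < ?q"
      using m by simp
    ultimately show ?thesis
      using True by (simp add: mult_2 card_Un_disjoint right_half_count_def)
  next
    case False
    let ?q = "(m + 1) div 4"
    have "?S = (\<lambda>i. 2 * i + 1) ` {..<?q} \<union> (\<lambda>i. 2 * m - (2 * i + 1)) ` {..<?q}" (is "_ = ?A \<union> ?B")
    proof (intro equalityI subsetI)
      fix a assume a: "a \<in> ?S"
      show "a \<in> ?A \<union> ?B"
      proof (cases "2 * a < m")
        case True
        have "a = 2 * (a div 2) + 1" "a div 2 < ?q"
          using a True False by auto presburger+
        then show ?thesis
          by blast
      next
        case g: False
        have "a = 2 * m - (2 * (m - 1 - a div 2) + 1)" "m - 1 - a div 2 < ?q"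
          using a g False by auto presburger+
        then show ?thesis
          by blast
      qed
    next
      fix a assume "a \<in> ?A \<union> ?B"
      then show "a \<in> ?S"
        using m False by auto
    qed
    moreover have "card ?A = ?q"
      by (simp add: card_image inj_on_def)
    moreover have "card ?B = ?q"
    proof -
      have "inj_on (\<lambda>i. 2 * m - (2 * i + 1)) {..<?q}"
        by (rule inj_onI) auto
      then show ?thesis
        by (simp add: card_image)
    qed
    moreover have "?A \<inter> ?B = {}"
      by auto
    ultimately show ?thesis
      using m False by (simp add: card_Un_disjoint right_half_count_def)
  qed
qed

text \<open>
  The sign of the cosine depends only on the residue, and the residues are a permutation of those of
  one parity: that of \<open>n s\<close>, since \<open>2 i n\<close> is even.
\<close>

lemma card_positive_rays:
  fixes m n s :: nat
  assumes m: "m > 0" and cop: "coprime m n"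
  shows "card {i. i < m \<and> cos (n * (pi * (2 * i + s) / m)) > 0} = right_half_count m (even (n * s))"
proof -
  let ?f = "\<lambda>i. n * (2 * i + s) mod (2 * m)"
  let ?R = "\<lambda>a. 2 * a < m \<or> 3 * m < 2 * a"
  have "cos (n * (pi * (2 * i + s) / m)) > 0 \<longleftrightarrow> ?R (?f i)" for i :: nat
    using cos_pos_iff_residue[OF m, of "n * (2 * i + s)"]
    by (simp add: algebra_simps)
  then have "card {i. i < m \<and> cos (n * (pi * (2 * i + s) / m)) > 0} = card {i. i < m \<and> ?R (?f i)}"
    by simp
  also have "\<dots> = card {a. a < 2 * m \<and> (even a \<longleftrightarrow> even (n * s)) \<and> ?R a}"
  proof (rule bij_betw_same_card[of ?f])
    note b = progression_residues[OF m cop, of s]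
    have "?f ` {i. i < m \<and> ?R (?f i)} = {a \<in> ?f ` {..<m}. ?R a}"
      by auto
    also have "\<dots> = {a. a < 2 * m \<and> (even a \<longleftrightarrow> even (n * s)) \<and> ?R a}"
      unfolding bij_betw_imp_surj_on[OF b] by auto
    finally show "bij_betw ?f {i. i < m \<and> ?R (?f i)}
        {a. a < 2 * m \<and> (even a \<longleftrightarrow> even (n * s)) \<and> ?R a}"
      by (auto intro: bij_betw_subset[OF b])
  qed
  finally show ?thesis
    by (simp add: card_residues_right_half[OF m])
qed

section \<open>Dependence of the zero count on the parameter\<close>

lemma sum_even_odd:
  fixes f g :: "nat \<Rightarrow> 'a :: comm_monoid_add"
  shows "(\<Sum>j<2 * m. if even j then f j else g j) = (\<Sum>i<m. f (2 * i)) + (\<Sum>i<m. g (2 * i + 1))"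
  by (induction m) (simp_all add: add_ac)

text \<open>
  The odd rays contribute a constant. All dependence on \<open>c\<close> sits in the sum over the even rays, each
  of whose terms is an explicit step function of \<open>c\<close>.
\<close>

lemma Z_as_sum:
  assumes m: "m > 0" and n: "n > 0" and cop: "coprime m n"
  obtains \<mu> :: real where "\<mu> > 0"
    and "\<And>c. c > 0 \<Longrightarrow> finite (zeros m (- int n) c)"
    and "\<And>c. c > 0 \<Longrightarrow> Z m (- int n) c =
      right_half_count m (even n) + (\<Sum>i<m. even_ray_count \<mu> (2 * c * cos (n * (pi * real (2 * i) / m))))"
proof -
  obtain \<mu> :: real where \<mu>: "\<mu> > 0"
    and fin: "\<And>A :: real. finite {r. 0 < r \<and> r ^ m + A / r ^ n = 1}"
    and crd: "\<And>A. card {r. 0 < r \<and> r ^ m + A / r ^ n = 1} = even_ray_count \<mu> A"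
    using even_ray_card[OF m n] by metis
  have even: "ray_radii m n c j = {r. 0 < r \<and> r ^ m + 2 * c * cos (n * (pi * j / m)) / r ^ n = 1}"
    if "even j" for c j
    using that by (simp add: ray_radii_def)
  have E: "finite (ray_radii m n c j)
      \<and> card (ray_radii m n c j) = even_ray_count \<mu> (2 * c * cos (n * (pi * j / m)))"
    if "even j" for c j
    unfolding even[OF that] by (intro conjI fin crd)
  have O: "finite (ray_radii m n c j)"
      "card (ray_radii m n c j) = (if cos (n * (pi * j / m)) > 0 then 1 else 0)"
    if "odd j" "c > 0" for c j
    using odd_ray_card[OF m n, of "2 * c * cos (n * (pi * j / m))"] that
    unfolding ray_radii_def by (simp_all add: zero_less_mult_iff)
  have fin': "finite (ray_radii m n c j)" if "c > 0" for c j
    using E O that by blast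
  show thesis
  proof (rule that[OF \<mu>])
    fix c :: real assume c: "c > 0"
    note b = zeros_bij_betw_ray_radii[OF m, of n c]
    show "finite (zeros m (- int n) c)"
      using bij_betw_finite[OF b] fin'[OF c] by blast
    have "Z m (- int n) c = (\<Sum>j<2 * m. card (ray_radii m n c j))"
      unfolding Z_def bij_betw_same_card[OF b, symmetric] using fin'[OF c] by simp
    also have "\<dots> = (\<Sum>j<2 * m. if even j then even_ray_count \<mu> (2 * c * cos (n * (pi * j / m)))
        else if cos (n * (pi * j / m)) > 0 then 1 else 0)"
      by (intro sum.cong) (auto simp: E O c)
    also have "\<dots> = (\<Sum>i<m. even_ray_count \<mu> (2 * c * cos (n * (pi * real (2 * i) / m))))
        + (\<Sum>i<m. if cos (n * (pi * (2 * i + 1) / m)) > 0 then 1 else 0)"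
      by (simp add: sum_even_odd)
    also have "(\<Sum>i<m. if cos (n * (pi * (2 * i + 1) / m)) > 0 then 1 else 0)
        = card {i. i < m \<and> cos (n * (pi * (2 * i + 1) / m)) > 0}"
      by (subst sum.If_cases) (simp_all add: Int_def add.commute)
    also have "\<dots> = right_half_count m (even n)"
      using card_positive_rays[OF m cop, of 1] by (simp add: add.commute)
    finally show "Z m (- int n) c = right_half_count m (even n)
        + (\<Sum>i<m. even_ray_count \<mu> (2 * c * cos (n * (pi * real (2 * i) / m))))"
      by simp
  qed
qed

lemma even_ray_count_antimono:
  assumes "0 < c" "c \<le> d"
  shows "even_ray_count \<mu> (2 * d * x) \<le> even_ray_count \<mu> (2 * c * x)"
proof (cases "x > 0")
  case True
  then have "0 < 2 * c * x" "2 * c * x \<le> 2 * d * x"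
    using assms by auto
  then show ?thesis
    by (auto simp: even_ray_count_def)
next
  case False
  then have "2 * c * x \<le> 0" "2 * d * x \<le> 0"
    using assms by (auto simp: mult_le_0_iff)
  then show ?thesis
    by (simp add: even_ray_count_def)
qed

theorem theorem2:
  fixes m M N :: nat and k :: int
  assumes "m > 0" and "k < 0" and "int m > \<bar>k\<bar>" and "gcd (int m) k = 1"
    and "m mod 4 = 0 \<longrightarrow> M = m + 1 \<and> N = m - 2"
    and "m mod 4 = 1 \<and> odd k \<longrightarrow> M = m - 1 \<and> N = m + 1"
    and "m mod 4 = 1 \<and> even k \<longrightarrow> M = m \<and> N = m + 1"
    and "m mod 4 = 2 \<longrightarrow> M = m - 1 \<and> N = m"
    and "m mod 4 = 3 \<and> odd k \<longrightarrow> M = m + 1 \<and> N = m - 1"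
    and "m mod 4 = 3 \<and> even k \<longrightarrow> M = m \<and> N = m - 1"
  shows "(\<forall>c>0. finite (zeros m k c)) \<and>
    antimono_on {0<..} (Z m k) \<and>
    (\<forall>c>0. M \<le> Z m k c \<and> Z m k c \<le> M + N) \<and>
    (\<exists>c>0. Z m k c = M + N) \<and>
    (\<exists>c>0. Z m k c = M)"
proof -
  define n where "n = nat (- k)"
  have k: "k = - int n" and n: "n > 0"
    using \<open>k < 0\<close> by (auto simp: n_def)
  have cop: "coprime m n"
    using \<open>gcd (int m) k = 1\<close> by (simp add: k coprime_iff_gcd_eq_1)
  obtain \<mu> :: real where \<mu>: "\<mu> > 0"
    and fin: "\<And>c. c > 0 \<Longrightarrow> finite (zeros m k c)"
    and Z: "\<And>c. c > 0 \<Longrightarrow> Z m k c = right_half_count m (even n)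
      + (\<Sum>i<m. even_ray_count \<mu> (2 * c * cos (n * (pi * real (2 * i) / m))))"
    by (rule Z_as_sum[OF \<open>m > 0\<close> n cop, folded k]) (rule that)
  define x :: "nat \<Rightarrow> real" where "x i = cos (n * (pi * real (2 * i) / m))" for i
  define P where "P = {i. i < m \<and> x i > 0}"
  have P: "P \<subseteq> {..<m}" "card P = right_half_count m True"
    using card_positive_rays[OF \<open>m > 0\<close> cop, of 0] by (auto simp: P_def x_def)
  (* Even rays outside P contribute 1 each for every c, so only the rays in P are sensitive to c. *)
  have nonpos: "even_ray_count \<mu> (2 * c * x i) = 1" if "c > 0" "i < m" "i \<notin> P" for c i
    using that by (simp add: P_def even_ray_count_def mult_le_0_iff)
  have Z': "Z m k c = right_half_count m (even n) + (m - card P)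
      + (\<Sum>i\<in>P. even_ray_count \<mu> (2 * c * x i))" if "c > 0" for c
  proof -
    have "(\<Sum>i<m. even_ray_count \<mu> (2 * c * x i))
        = (\<Sum>i\<in>{..<m} - P. even_ray_count \<mu> (2 * c * x i))
          + (\<Sum>i\<in>P. even_ray_count \<mu> (2 * c * x i))"
      using P by (intro sum.subset_diff) auto
    also have "(\<Sum>i\<in>{..<m} - P. even_ray_count \<mu> (2 * c * x i)) = card ({..<m} - P)"
      using nonpos[OF that] by simp
    also have "\<dots> = m - card P"
      using P by (simp add: card_Diff_subset finite_subset)
    finally show ?thesis
      using Z[OF that] by (simp add: x_def)
  qed
  (* By coprimality; so for even m the odd rays are counted by odd residues. *)
  have k_odd: "odd k" if "even m"
    using cop that by (auto simp: k coprime_def)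
  have MN: "M = right_half_count m (even n) + (m - card P) \<and> N = 2 * card P"
  proof -
    have parity: "even n \<longleftrightarrow> even k"
      by (simp add: k)
    note count = right_half_count_by_residue[OF \<open>m > 0\<close>]
    have "m mod 4 < 4"
      by simp
    then consider "m mod 4 = 0" | "m mod 4 = 1" | "m mod 4 = 2" | "m mod 4 = 3"
      by linarith
    then show ?thesis
    proof cases
      case 1
      then have "odd k"
        using k_odd by presburger
      then show ?thesis
        using assms(5) count(1)[OF 1] 1 by (auto simp: P parity)
    next
      case 2
      then show ?thesis
        using assms(6,7) count(2)[OF 2] by (cases "even k") (auto simp: P parity)
    next
      case 3
      then have "odd k"
        using k_odd by presburger
      then show ?thesis
        using assms(8) count(3)[OF 3] 3 by (auto simp: P parity)
    next
      case 4
      then show ?thesis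
        using assms(9,10) count(4)[OF 4] by (cases "even k") (auto simp: P parity)
    qed
  qed
  have upper: "(\<Sum>i\<in>P. even_ray_count \<mu> (2 * c * x i)) \<le> N" for c
    using sum_bounded_above[of P "\<lambda>i. even_ray_count \<mu> (2 * c * x i)" 2]
    by (simp add: MN even_ray_count_def mult.commute)
  (* Cosines are at most 1, so for c = \<mu> / 4 every even ray stays strictly below the threshold. *)
  have "Z m k (\<mu> / 4) = M + N"
  proof -
    have "even_ray_count \<mu> (2 * (\<mu> / 4) * x i) = 2" if "i \<in> P" for i
    proof -
      have "0 < x i" "x i \<le> 1"
        using that by (auto simp: P_def x_def)
      then have "0 < \<mu> * x i" "\<mu> * x i \<le> \<mu> * 1"
        using \<mu> by (auto intro!: mult_left_mono)
      then show ?thesis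
        using \<mu> by (simp add: even_ray_count_def)
    qed
    then show ?thesis
      using Z'[of "\<mu> / 4"] \<mu> MN by simp
  qed
  moreover have "\<exists>c>0. Z m k c = M"
  proof -
    (* The set P is finite, so one large c lifts all positive levels above the threshold. *)
    have "\<forall>\<^sub>F c in at_top. \<forall>i\<in>P. c > \<mu> / x i"
      using P by (intro eventually_ball_finite ballI eventually_gt_at_top) (auto intro: finite_subset)
    then have "\<forall>\<^sub>F c in at_top. c > 0 \<and> (\<forall>i\<in>P. c > \<mu> / x i)"
      using eventually_gt_at_top[of 0] by eventually_elim auto
    then obtain c where c: "c > 0" "\<And>i. i \<in> P \<Longrightarrow> c > \<mu> / x i"
      using eventually_happens'[OF trivial_limit_at_top_linorder] by blast
    have "even_ray_count \<mu> (2 * c * x i) = 0" if "i \<in> P" for i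
    proof -
      have "0 < x i" "\<mu> < c * x i"
        using c(2)[OF that] that by (auto simp: P_def field_simps)
      then show ?thesis
        using \<mu> c(1) by (simp add: even_ray_count_def not_le)
    qed
    then show ?thesis
      using Z'[OF c(1)] c(1) MN by auto
  qed
  moreover have "antimono_on {0<..} (Z m k)"
    by (intro monotone_onI) (auto simp: Z intro!: sum_mono even_ray_count_antimono)
  moreover have "M \<le> Z m k c \<and> Z m k c \<le> M + N" if "c > 0" for c
    using Z'[OF that] upper[of c] MN by simp
  moreover have "\<mu> / 4 > 0"
    using \<mu> by simp
  ultimately show ?thesis
    using fin by blast
qed

end
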